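(* Let $(\mathcal{B},\mu)$ be a strictly positive atomless normalized measure algebra. For every fixed $x\in[0,1]$, $$\sup\{D(a,b): a,b\in\mathcal{B},\ \mu(a)=\mu(b)=x\}=\min\{x,1-x\}.$$
   Context: A strictly positive atomless normalized measure algebra $(\mathcal{B},\mu)$ is a Dedekind $\sigma$-complete Boolean algebra $\mathcal{B}$ with a countably additive $\mu:\mathcal{B}\to[0,1]$ such that $\mu(1)=1$, $\mu(a)>0$ for every $a\neq 0$, and $\mathcal{B}$ has no atoms. For $a,b\in\mathcal{B}$, $D(a,b):=\sup_{c\in\mathcal{B}}|\mu(a\wedge c)-\mu(b\wedge c)|$. *)

theory Defs
  imports "HOL-Analysis.Analysis" "HOL-Library.Countable_Complete_Lattices"
begin

definition bool_atom :: "'a::boolean_algebra \<Rightarrow> bool" where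
  "bool_atom a \<longleftrightarrow> a \<noteq> bot \<and> (\<forall>b\<le>a. b = bot \<or> b = a)"

text \<open>
  The Boolean algebra is the whole type. Dedekind sigma-completeness is the sort constraint
  \<^class>\<open>countable_complete_lattice\<close>, which shares its order and lattice operations with
  \<^class>\<open>boolean_algebra\<close> and gives \<^const>\<open>Sup\<close> a meaning on countable sets only.
\<close>

locale atomless_measure_algebra =
  fixes \<mu> :: "'a::{boolean_algebra, countable_complete_lattice} \<Rightarrow> real"
  assumes range_unit: "\<mu> a \<in> {0..1}"
    and countably_additive:
      "(\<And>i j. i \<noteq> j \<Longrightarrow> inf (A i) (A j) = bot) \<Longrightarrow>
        (\<lambda>i. \<mu> (A i)) sums \<mu> (SUP i::nat. A i)"
    and normalized: "\<mu> top = 1"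
    and strictly_positive: "a \<noteq> bot \<Longrightarrow> \<mu> a > 0"
    and atomless: "\<not> bool_atom (a::'a)"

text \<open>For a measure algebra the supremum is over a nonempty set of reals bounded by 1.\<close>

definition measure_disc :: "('a::boolean_algebra \<Rightarrow> real) \<Rightarrow> 'a \<Rightarrow> 'a \<Rightarrow> real" where
  "measure_disc \<mu> a b = (SUP c. \<bar>\<mu> (inf a c) - \<mu> (inf b c)\<bar>)"

end

theory Submission
  imports Defs
begin

text \<open>
  For \<open>\<mu> a = \<mu> b = x\<close> the difference \<open>\<mu> (a \<sqinter> c) - \<mu> (b \<sqinter> c)\<close> is at most \<open>x\<close>, and by
  \<open>\<mu> (b \<sqinter> c) \<ge> x + \<mu> c - 1\<close> at most \<open>1 - x\<close>. The bound is attained at two elements of measure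
  \<open>x\<close> that are disjoint (\<open>x \<le> 1/2\<close>) or have disjoint complements (\<open>x \<ge> 1/2\<close>). They
  exist by Sierpinski's theorem that every \<open>a\<close> has subelements of all measures
  \<open>t \<in> [0, \<mu> a]\<close>. To see this, exhaust greedily: always add a piece whose measure is at least half
  of what fits. If the union stayed below \<open>t\<close>, a small nonzero piece of the rest would still fit,
  so the measures of the added pieces would not tend to 0.
\<close>

context atomless_measure_algebra
begin

section \<open>Finite additivity and monotonicity of the measure\<close>

lemma measure_nonneg [simp]: "0 \<le> \<mu> a" and measure_le_1 [simp]: "\<mu> a \<le> 1"
  using range_unit[of a] by auto

text \<open>The constant sequence \<open>bot\<close> is pairwise disjoint, and a constant series
  converges only if its term is 0.\<close>

lemma measure_bot [simp]: "\<mu> bot = 0"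
proof -
  have "(\<lambda>i::nat. \<mu> bot) sums \<mu> (SUP i::nat. bot)"
    by (rule countably_additive) auto
  then show ?thesis
    using summable_const_iff[of "\<mu> bot"] sums_summable by blast
qed

lemma measure_sup_disjoint:
  assumes "inf a b = bot"
  shows "\<mu> (sup a b) = \<mu> a + \<mu> b"
proof -
  define A where "A i = (if i = 0 then a else if i = 1 then b else bot)" for i :: nat
  have "(\<lambda>i. \<mu> (A i)) sums \<mu> (SUP i. A i)"
    by (rule countably_additive) (use assms in \<open>auto simp: A_def inf_commute\<close>)
  moreover have "(SUP i. A i) = sup a b"
  proof (rule antisym)
    show "(SUP i. A i) \<le> sup a b"
      by (rule ccSUP_least) (auto simp: A_def)
    have "A 0 \<le> (SUP i. A i)" "A 1 \<le> (SUP i. A i)"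
      by (rule ccSUP_upper; simp)+
    then show "sup a b \<le> (SUP i. A i)" by (simp add: A_def)
  qed
  moreover have "(\<lambda>i. \<mu> (A i)) sums (\<Sum>i\<in>{0,1}. \<mu> (A i))"
    by (rule sums_finite) (auto simp: A_def)
  ultimately show ?thesis
    by (auto simp: A_def dest: sums_unique2)
qed

lemma measure_split: "\<mu> a = \<mu> (inf a b) + \<mu> (inf a (- b))"
proof -
  have "sup (inf a b) (inf a (- b)) = a"
    by (simp flip: inf_sup_distrib1)
  moreover have "inf (inf a b) (inf a (- b)) = bot"
    by (metis boolean_algebra.conj_cancel_right inf.left_commute inf_bot_right inf_assoc)
  ultimately show ?thesis
    using measure_sup_disjoint by metis
qed

lemma measure_mono: "a \<le> b \<Longrightarrow> \<mu> a \<le> \<mu> b"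
  using measure_split[of b a] by (simp add: inf_absorb2)

lemma measure_uminus: "\<mu> (- a) = 1 - \<mu> a"
  using measure_split[of top a] normalized by simp

lemma measure_inf_lower: "\<mu> a + \<mu> b - 1 \<le> \<mu> (inf a b)"
proof -
  have "\<mu> (inf a (- b)) \<le> \<mu> (- b)"
    by (rule measure_mono) simp
  then show ?thesis
    using measure_split[of a b] by (simp add: measure_uminus)
qed

section \<open>Small elements, greedy choice and Sierpinski's theorem\<close>

lemma ex_half_measure:
  assumes "a \<noteq> bot"
  shows "\<exists>b\<le>a. b \<noteq> bot \<and> \<mu> b \<le> \<mu> a / 2"
proof -
  obtain b where b: "b \<le> a" "b \<noteq> bot" "b \<noteq> a"
    using atomless[of a] assms unfolding bool_atom_def by blast
  \<comment> \<open>\<open>b\<close> and \<open>c\<close> split \<open>a\<close> into two nonzero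
    pieces, and the lighter one has at most half the measure.\<close>
  define c where "c = inf a (- b)"
  have "c \<noteq> bot"
    using b unfolding c_def by (metis antisym inf_shunt double_compl)
  moreover have "\<mu> a = \<mu> b + \<mu> c"
    using measure_split[of a b] b by (simp add: c_def inf_absorb2)
  moreover have "c \<le> a" by (simp add: c_def)
  moreover have "\<mu> b \<le> \<mu> a / 2 \<or> \<mu> c \<le> \<mu> a / 2"
    using calculation by linarith
  ultimately show ?thesis
    using b by blast
qed

lemma ex_small_measure:
  assumes "a \<noteq> bot" "0 < e"
  shows "\<exists>b\<le>a. b \<noteq> bot \<and> \<mu> b < e"
proof -
  have *: "\<exists>b\<le>a. b \<noteq> bot \<and> \<mu> b \<le> (1/2) ^ n" for n
  proof (induction n)
    case 0
    then show ?case using assms by (auto intro: exI[of _ a])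
  next
    case (Suc n)
    then obtain b where b: "b \<le> a" "b \<noteq> bot" "\<mu> b \<le> (1/2) ^ n" by blast
    obtain c where "c \<le> b" "c \<noteq> bot" "\<mu> c \<le> \<mu> b / 2"
      using ex_half_measure[OF b(2)] by blast
    then show ?case using b by (intro exI[of _ c]) auto
  qed
  obtain n where "(1/2) ^ n < e"
    using real_arch_pow_inv[OF assms(2), of "1/2"] by auto
  then show ?thesis using *[of n] by (meson le_less_trans)
qed

text \<open>The supremum of the measures that fit is not yet known to be attained, so the choice
  only has to exceed half of it. If the supremum is 0, \<open>bot\<close> will do.\<close>

lemma ex_greedy:
  assumes "0 \<le> s"
  shows "\<exists>c\<le>r. \<mu> c \<le> s \<and> (\<forall>d\<le>r. \<mu> d \<le> s \<longrightarrow> \<mu> d \<le> 2 * \<mu> c)"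
proof -
  define S where "S = {\<mu> d | d. d \<le> r \<and> \<mu> d \<le> s}"
  have bdd: "bdd_above S"
    unfolding S_def by (rule bdd_aboveI[of _ 1]) auto
  have ne: "0 \<in> S"
    unfolding S_def using assms by (auto intro!: exI[of _ bot])
  have ub: "\<mu> d \<le> Sup S" if "d \<le> r" "\<mu> d \<le> s" for d
    using that bdd by (intro cSup_upper) (auto simp: S_def)
  show ?thesis
  proof (cases "Sup S > 0")
    case True
    then obtain y where "y \<in> S" "Sup S / 2 < y"
      using ne bdd by (metis empty_iff field_sum_of_halves less_add_same_cancel1 less_cSup_iff half_gt_zero)
    then show ?thesis
      using ub unfolding S_def by fastforce
  next
    case False
    then show ?thesis
      using ub assms by (intro exI[of _ bot]) force
  qed
qed

theorem sierpinski:
  assumes "0 \<le> t" "t \<le> \<mu> a"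
  shows "\<exists>b\<le>a. \<mu> b = t"
proof -
  define step where "step b c \<longleftrightarrow> c \<le> inf a (- b) \<and> \<mu> c \<le> t - \<mu> b \<and>
    (\<forall>d\<le>inf a (- b). \<mu> d \<le> t - \<mu> b \<longrightarrow> \<mu> d \<le> 2 * \<mu> c)" for b c
  have step_measure: "\<mu> (sup b c) = \<mu> b + \<mu> c" if "step b c" for b c
  proof (rule measure_sup_disjoint)
    have "c \<le> - b" using that by (simp add: step_def)
    then have "inf c b = bot" by (simp only: inf_shunt)
    then show "inf b c = bot" by (simp only: inf_commute)
  qed
  \<comment> \<open>The invariant \<open>\<mu> (b n) \<le> t\<close> keeps the remaining budget
    nonnegative, as \<open>ex_greedy\<close> requires.\<close>
  have "\<exists>b. \<forall>n. (b n \<le> a \<and> \<mu> (b n) \<le> t) \<and> (\<exists>c. step (b n) c \<and> b (Suc n) = sup (b n) c)"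
  proof (rule dependent_nat_choice)
    show "\<exists>b. b \<le> a \<and> \<mu> b \<le> t"
      using assms by (intro exI[of _ bot]) simp
    fix b and n :: nat
    assume b: "b \<le> a \<and> \<mu> b \<le> t"
    then obtain c where c: "step b c"
      using ex_greedy[of "t - \<mu> b" "inf a (- b)"] unfolding step_def by auto
    then show "\<exists>b'. (b' \<le> a \<and> \<mu> b' \<le> t) \<and> (\<exists>c. step b c \<and> b' = sup b c)"
      using b step_measure[OF c] by (intro exI[of _ "sup b c"]) (auto simp: step_def)
  qed
  then obtain b c where b: "\<And>n. b n \<le> a" "\<And>n. \<mu> (b n) \<le> t"
    and c: "\<And>n. step (b n) (c n)" and b_Suc: "\<And>n. b (Suc n) = sup (b n) (c n)"
    by metis
  \<comment> \<open>Dependent choice does not fix \<open>b 0\<close> to be \<open>bot\<close>, so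
    \<open>b 0\<close> is counted as the first piece. The index shift makes \<open>b n\<close> the
    union of \<open>C 0\<close>, ..., \<open>C n\<close>.\<close>
  define C where "C i = (case i of 0 \<Rightarrow> b 0 | Suc n \<Rightarrow> c n)" for i
  have b_mono: "b m \<le> b n" if "m \<le> n" for m n
    using that by (rule lift_Suc_mono_le[rotated]) (simp add: b_Suc)
  have C_le_b: "C n \<le> b n" for n
    by (cases n) (auto simp: C_def b_Suc)
  have disj: "inf (C i) (C j) = bot" if "i < j" for i j
  proof -
    obtain k where k: "j = Suc k" "i \<le> k" using \<open>i < j\<close> by (cases j) auto
    have "C j \<le> - b k" using c[of k] by (simp add: C_def k step_def)
    moreover have "C i \<le> b k" using C_le_b b_mono[OF k(2)] by (rule order_trans)
    ultimately have "inf (C i) (C j) \<le> inf (b k) (- b k)" by (intro inf_mono)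
    then show ?thesis by (simp add: bot_unique)
  qed
  define s where "s = (SUP i. C i)"
  have sums: "(\<lambda>i. \<mu> (C i)) sums \<mu> s"
    unfolding s_def
    by (rule countably_additive) (metis disj inf_commute linorder_neqE_nat)
  have partial: "(\<Sum>i\<le>n. \<mu> (C i)) = \<mu> (b n)" for n
    by (induction n) (auto simp: C_def b_Suc step_measure[OF c])
  have "\<mu> s \<le> t"
    using sums unfolding sums_def_le by (rule LIMSEQ_le_const2) (auto simp: partial b)
  moreover have s_le: "s \<le> a"
    unfolding s_def by (rule ccSUP_least) (use C_le_b b order_trans in blast)+
  have C_le_s: "C n \<le> s" for n
    unfolding s_def by (rule ccSUP_upper) auto
  have b_le_s: "b n \<le> s" for n
  proof (induction n)
    case 0
    then show ?case using C_le_s[of 0] by (simp add: C_def)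
  next
    case (Suc n)
    then show ?case using C_le_s[of "Suc n"] by (simp add: C_def b_Suc)
  qed
  moreover have "\<not> \<mu> s < t"
  proof
    assume less: "\<mu> s < t"
    then have "inf a (- s) \<noteq> bot"
      using measure_split[of a s] s_le assms by (auto simp: inf_absorb2)
    then obtain d where d: "d \<le> inf a (- s)" "d \<noteq> bot" "\<mu> d < t - \<mu> s"
      using ex_small_measure[of "inf a (- s)" "t - \<mu> s"] less by auto
    \<comment> \<open>Since \<open>b n \<le> s\<close>, the piece \<open>d\<close> still fits at
      every stage, so each greedy choice has at least half its measure. This contradicts the
      convergence of the series.\<close>
    have "\<mu> d / 2 \<le> \<mu> (C (Suc n))" for n
    proof -
      have "inf a (- s) \<le> inf a (- b n)"
        using b_le_s by (intro inf_mono) auto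
      then have "d \<le> inf a (- b n)" using d(1) by (rule order_trans[rotated])
      moreover have "\<mu> d \<le> t - \<mu> (b n)"
        using d(3) measure_mono[OF b_le_s[of n]] by simp
      ultimately show ?thesis
        using c[of n] by (auto simp: step_def C_def)
    qed
    moreover have "(\<lambda>n. \<mu> (C (Suc n))) \<longlonglongrightarrow> 0"
      using summable_LIMSEQ_zero[OF sums_summable[OF sums]] by (rule LIMSEQ_Suc)
    ultimately have "\<mu> d / 2 \<le> 0"
      by (intro LIMSEQ_le_const) auto
    then show False using strictly_positive[OF d(2)] by simp
  qed
  ultimately show ?thesis using s_le by (intro exI[of _ s]) auto
qed

section \<open>Bounds on the discrepancy and extremal pairs\<close>

lemma ex_disjoint_of_measure:
  assumes "0 \<le> x" "x \<le> 1/2"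
  shows "\<exists>a b. \<mu> a = x \<and> \<mu> b = x \<and> b \<le> - a"
proof -
  obtain a where a: "\<mu> a = x"
    using sierpinski[of x top] assms normalized by auto
  \<comment> \<open>There is room in the complement: it has measure
    \<open>1 - x \<ge> x\<close>.\<close>
  then show ?thesis
    using sierpinski[of x "- a"] assms by (auto simp: measure_uminus)
qed

text \<open>Both measures lie between \<open>max 0 (x + \<mu> c - 1)\<close> and
  \<open>min x (\<mu> c)\<close>, an interval of length at most
  \<open>min x (1 - x)\<close>.\<close>

lemma measure_diff_le:
  assumes "\<mu> a = x" "\<mu> b = x"
  shows "\<bar>\<mu> (inf a c) - \<mu> (inf b c)\<bar> \<le> min x (1 - x)"
proof -
  have "\<mu> (inf a c) \<le> x" "\<mu> (inf b c) \<le> x" "\<mu> (inf a c) \<le> \<mu> c" "\<mu> (inf b c) \<le> \<mu> c"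
    using measure_mono[of "inf a c" a] measure_mono[of "inf b c" b]
      measure_mono[of "inf a c" c] measure_mono[of "inf b c" c] assms by auto
  moreover have "x + \<mu> c - 1 \<le> \<mu> (inf a c)" "x + \<mu> c - 1 \<le> \<mu> (inf b c)"
    using measure_inf_lower[of a c] measure_inf_lower[of b c] assms by auto
  ultimately show ?thesis
    using measure_nonneg[of "inf a c"] measure_nonneg[of "inf b c"] by linarith
qed

lemma measure_disc_le:
  assumes "\<mu> a = x" "\<mu> b = x"
  shows "measure_disc \<mu> a b \<le> min x (1 - x)"
  unfolding measure_disc_def
  by (rule cSUP_least) (rule UNIV_not_empty measure_diff_le[OF assms])+

lemma measure_disc_eqI:
  assumes "\<mu> a = x" "\<mu> b = x" "\<bar>\<mu> (inf a c) - \<mu> (inf b c)\<bar> = min x (1 - x)"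
  shows "measure_disc \<mu> a b = min x (1 - x)"
  unfolding measure_disc_def
proof (rule cSup_eq_maximum)
  show "min x (1 - x) \<in> range (\<lambda>c. \<bar>\<mu> (inf a c) - \<mu> (inf b c)\<bar>)"
    using assms(3)[symmetric] by (rule range_eqI)
qed (use measure_diff_le[OF assms(1,2)] in auto)

lemma ex_extremal_pair:
  assumes "x \<in> {0..1}"
  shows "\<exists>a b. \<mu> a = x \<and> \<mu> b = x \<and> measure_disc \<mu> a b = min x (1 - x)"
proof (cases "x \<le> 1/2")
  case True
  then obtain a b where ab: "\<mu> a = x" "\<mu> b = x" "b \<le> - a"
    using ex_disjoint_of_measure[of x] assms by auto
  then have "inf b a = bot" by (simp add: inf_shunt)
  then have "measure_disc \<mu> a b = min x (1 - x)"
    \<comment> \<open>Testing with \<open>c = a\<close> compares \<open>\<mu> a = x\<close> with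
      \<open>\<mu> bot = 0\<close>.\<close>
    using True assms ab by (intro measure_disc_eqI[where c = a]) auto
  then show ?thesis using ab by blast
next
  case False
  then obtain a b where ab: "\<mu> a = 1 - x" "\<mu> b = 1 - x" "b \<le> - a"
    using ex_disjoint_of_measure[of "1 - x"] assms by auto
  then have "inf (- a) b = b" by (simp add: inf_absorb2)
  then have "measure_disc \<mu> (- a) (- b) = min x (1 - x)"
    \<comment> \<open>Testing with \<open>c = b\<close> compares \<open>\<mu> b = 1 - x\<close> with
      \<open>\<mu> bot = 0\<close>, because \<open>b\<close> lies in \<open>- a\<close> and misses
      \<open>- b\<close>.\<close>
    using False assms ab by (intro measure_disc_eqI[where c = b]) (auto simp: measure_uminus)
  then show ?thesis
    using ab by (intro exI[of _ "- a"] exI[of _ "- b"]) (simp add: measure_uminus)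
qed

end

theorem corollary2:
  fixes \<mu> :: "'a::{boolean_algebra, countable_complete_lattice} \<Rightarrow> real"
    and x :: real
  assumes "atomless_measure_algebra \<mu>"
    and "x \<in> {0..1}"
  shows "Sup {measure_disc \<mu> a b | a b. \<mu> a = x \<and> \<mu> b = x} = min x (1 - x)"
proof (rule cSup_eq_maximum)
  interpret atomless_measure_algebra \<mu> by fact
  show "min x (1 - x) \<in> {measure_disc \<mu> a b | a b. \<mu> a = x \<and> \<mu> b = x}"
    using ex_extremal_pair[OF assms(2)] by (metis (mono_tags, lifting) mem_Collect_eq)
  show "y \<le> min x (1 - x)" if "y \<in> {measure_disc \<mu> a b | a b. \<mu> a = x \<and> \<mu> b = x}" for y
    using that measure_disc_le by blast
qed

end
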